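(* Let $n,d\ge 1$ and let $v_1,\dots,v_n$ be unit vectors in $\mathbb{R}^d$, no two of which are parallel. Let $P(x)=\prod_{j=1}^n\langle v_j,x\rangle$ for $x\in\mathbb{R}^d$, and let $\mathscr{E}(P)$ be the set of local extrema of $P$ on the sphere. Then there exists a weight function $\mu:\mathscr{E}(P)\to(0,\infty)$ such that $$\sum_{u\in\mathscr{E}(P)}\left(\sum_{j=1}^n\frac{1}{\langle v_j,u\rangle^2}-n^2\right)\mu(u)=0.$$ Furthermore, $\mu$ is given by $$\mu(u)=\det\left(I+\frac1n\sum_{j=1}^n\frac{v_j\otimes v_j}{\langle v_j,u\rangle^2}\right)^{-1}.$$
   Context: $\langle\cdot,\cdot\rangle$ is the standard inner product on $\mathbb{R}^d$ and $\mathbb{S}^{d-1}$ is the unit sphere. $\mathscr{E}(P)$ is the set of points $u\in\mathbb{S}^{d-1}$ such that $\nabla P(u)$ is proportional to $u$ and $P(u)\neq0$; this set is finite, so the sum is a finite sum. $I$ is the $d\times d$ identity matrix and $v\otimes v$ denotes the rank-one matrix $vv^{T}$. Two unit vectors $v,w$ are parallel if $v=\pm w$. *)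

theory Defs
  imports "HOL-Analysis.Analysis"
begin

definition prod_linear_forms :: "nat \<Rightarrow> (nat \<Rightarrow> real^'d) \<Rightarrow> real^'d \<Rightarrow> real" where
  "prod_linear_forms n v x = (\<Prod>j=1..n. v j \<bullet> x)"

(* The local extrema of P on the unit sphere are taken to be its critical points there
   (gradient proportional to the position vector) at which P does not vanish. *)
definition sphere_extrema :: "(real^'d \<Rightarrow> real) \<Rightarrow> (real^'d) set" where
  "sphere_extrema P = {u \<in> sphere 0 1. (\<exists>c. GDERIV P u :> (c *\<^sub>R u)) \<and> P u \<noteq> 0}"

definition outer_product :: "real^'d \<Rightarrow> real^'d \<Rightarrow> real^'d^'d" where
  "outer_product v w = (\<chi> i j. v $ i * w $ j)"

definition parallel :: "real^'d \<Rightarrow> real^'d \<Rightarrow> bool" where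
  "parallel v w \<longleftrightarrow> v = w \<or> v = - w"

end

theory Submission
  imports Defs "HOL-Library.Function_Algebras"
begin

text \<open>
  Write \<open>w\<^sub>j(x) = 1 / \<langle>v\<^sub>j, x\<rangle>\<close>.  Dividing \<open>\<nabla>P(u) = c u\<close> by \<open>P(u)\<close> shows that the extrema are
  the solutions of \<open>\<Sum>\<^sub>j w\<^sub>j(u) v\<^sub>j = n u\<close>, that is, the zeros of the map
  \<open>\<Phi>(x) = x - (1/n) \<Sum>\<^sub>j w\<^sub>j(x) v\<^sub>j\<close>, and \<open>1 / \<mu>(u)\<close> is the Jacobian determinant of \<open>\<Phi>\<close> at \<open>u\<close>.
  The asserted identity is the combination of two residue formulas for this system:
  \<open>\<Sum>\<^sub>u \<mu>(u) = 1\<close>, and \<open>\<Sum>\<^sub>u w\<^sub>j(u)\<^sup>2 \<mu>(u) = n\<close> for each single \<open>j\<close>.  They hold because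
  the real zeros of \<open>\<Phi>\<close> are numerous enough: one in each chamber of an arrangement of hyperplanes.

  The function \<open>K(x, y) = det (I + (1/n) \<Sum>\<^sub>j w\<^sub>j(x) w\<^sub>j(y) v\<^sub>j v\<^sub>j\<^sup>T)\<close> is a Bezoutian of the system.
  Since \<open>w\<^sub>j(x) - w\<^sub>j(y) = - w\<^sub>j(x) w\<^sub>j(y) \<langle>v\<^sub>j, x - y\<rangle>\<close>, its matrix sends \<open>x - y\<close> to
  \<open>\<Phi>(x) - \<Phi>(y)\<close>.  So \<open>K(x, y) = 0\<close> for two different extrema, while \<open>K(y, y) = 1 / \<mu>(y)\<close>
  (\<open>bezoutian_off_diagonal\<close>).  On the other hand \<open>K\<close> has a Cauchy-Binet expansion
  \<open>K(x, y) = \<Sum>\<^sub>S c\<^sub>S w\<^sub>S(x) w\<^sub>S(y)\<close> into products \<open>w\<^sub>S = \<Prod>\<^sub>s\<^sub>\<in>\<^sub>S w\<^sub>s\<close>, over the \<open>S\<close> with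
  \<open>(v\<^sub>s)\<^sub>s\<^sub>\<in>\<^sub>S\<close> linearly independent (\<open>det_rank_one_perturbation\<close>).  Together, the point mass at an
  extremum \<open>y\<close> is \<open>\<Sum>\<^sub>S c\<^sub>S \<mu>(y) w\<^sub>S(y) w\<^sub>S\<close> as a function on the set \<open>E\<close> of extrema.

  Multiplying by \<open>w\<^sub>b(y)\<close> and summing over \<open>y\<close> writes \<open>w\<^sub>b\<close> as a combination of the \<open>w\<^sub>S\<close> in which
  \<open>w\<^sub>b\<close> itself has the coefficient \<open>c\<^sub>b \<Sum>\<^sub>y w\<^sub>b(y)\<^sup>2 \<mu>(y)\<close>.  For \<open>b = {}\<close> and \<open>b = {j}\<close>, where
  \<open>c\<^sub>b = 1\<close> and \<open>c\<^sub>b = 1/n\<close>, the residue formulas say that this coefficient is \<open>1\<close>.  It is, provided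
  that no linear relation on \<open>E\<close> between the \<open>w\<^sub>S\<close> involves \<open>w\<^sub>b\<close>.

  The last point is a dimension count.  The relations between the \<open>w\<^sub>S\<close> come from linear relations
  between the vectors and preserve \<open>|S|\<close>; with them each \<open>w\<^sub>S\<close> reduces to products over sets without
  broken circuits of the same size (\<open>recip_monomial_in_nbc_span\<close>), and a \<open>b\<close> with \<open>|b| \<le> 1\<close> is such
  a set.  There are at most as many sets without broken circuits as chambers of the
  arrangement \<open>{x. \<langle>v\<^sub>j, x\<rangle> = 0}\<close> (\<open>card_nbc_le_card_chambers\<close>), and each chamber contains exactly
  one extremum (\<open>card_critical_points\<close>).  As the functions \<open>w\<^sub>B\<close> span all functions on \<open>E\<close>, by the
  formula for the point masses, and there are no more of them than points in \<open>E\<close>, none can be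
  omitted (\<open>nbc_monomial_not_in_span\<close>).
\<close>

section \<open>Sets without broken circuits are at most as many as chambers\<close>

text \<open>
  A broken circuit is a minimal linearly dependent set of indices with its least element \<open>c\<close> removed.
  An independent \<open>S\<close> contains the one belonging to \<open>c\<close> exactly if \<open>v c\<close> lies in the span of the later
  \<open>v s\<close> with \<open>s \<in> S\<close>; a dependent \<open>S\<close> satisfies this with a \<open>c \<in> S\<close>, so the condition also
  enforces independence.  The vectors in \<open>U\<close> are divided out: this is the contraction, or restriction
  to \<open>U\<^sup>\<bottom>\<close>, that the induction on the number of hyperplanes passes to.
\<close>

definition no_broken_circuit :: "'a::real_vector set \<Rightarrow> (nat \<Rightarrow> 'a) \<Rightarrow> nat set \<Rightarrow> nat set \<Rightarrow> bool" where
  "no_broken_circuit U v I S \<longleftrightarrow> S \<subseteq> I \<and> (\<forall>c\<in>I. v c \<notin> span (U \<union> v ` {s\<in>S. c < s}))"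

definition sign_pattern :: "(nat \<Rightarrow> 'a::real_inner) \<Rightarrow> nat set \<Rightarrow> 'a \<Rightarrow> nat \<Rightarrow> real" where
  "sign_pattern v I x = (\<lambda>i. if i \<in> I then sgn (v i \<bullet> x) else 0)"

text \<open>
  A chamber of the arrangement restricted to \<open>U\<^sup>\<bottom>\<close> is represented by its vector of signs.
\<close>

definition chambers :: "'a::real_inner set \<Rightarrow> (nat \<Rightarrow> 'a) \<Rightarrow> nat set \<Rightarrow> (nat \<Rightarrow> real) set" where
  "chambers U v I = sign_pattern v I ` {x. (\<forall>u\<in>U. u \<bullet> x = 0) \<and> (\<forall>i\<in>I. v i \<bullet> x \<noteq> 0)}"

lemma finite_chambers:
  assumes "finite I"
  shows "finite (chambers U v I)"
proof -
  have "chambers U v I \<subseteq> {f. \<forall>i. (i \<in> I \<longrightarrow> f i \<in> {-1,0,1}) \<and> (i \<notin> I \<longrightarrow> f i = 0)}"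
    by (auto simp: chambers_def sign_pattern_def sgn_real_def split: if_splits)
  then show ?thesis
    using finite_set_of_finite_funs[OF assms, of "{-1,0,1::real}" 0] finite_subset by blast
qed

text \<open>
  Deletion and contraction of the largest index.  Being largest, \<open>n\<close> is among the later elements for
  every other \<open>c\<close>, so removing it from \<open>S\<close> is the same as moving \<open>v n\<close> to the vectors divided out.
\<close>

lemma nbc_insert_max:
  assumes "\<forall>i\<in>I. i < n"
  shows "{S. no_broken_circuit U v (insert n I) S} \<subseteq>
    {S. no_broken_circuit U v I S} \<union> insert n ` {S. no_broken_circuit (insert (v n) U) v I S}"
proof
  fix S assume "S \<in> {S. no_broken_circuit U v (insert n I) S}"
  then have S: "S \<subseteq> insert n I" and nb: "\<And>c. c \<in> insert n I \<Longrightarrow> v c \<notin> span (U \<union> v ` {s\<in>S. c < s})"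
    by (auto simp: no_broken_circuit_def)
  show "S \<in> {S. no_broken_circuit U v I S} \<union> insert n ` {S. no_broken_circuit (insert (v n) U) v I S}"
  proof (cases "n \<in> S")
    case False
    then show ?thesis using S nb by (auto simp: no_broken_circuit_def)
  next
    case True
    have eq: "insert (v n) U \<union> v ` {s \<in> S - {n}. c < s} = U \<union> v ` {s\<in>S. c < s}" if "c \<in> I" for c
      using True that assms by auto
    have "no_broken_circuit (insert (v n) U) v I (S - {n})"
      unfolding no_broken_circuit_def
    proof (intro conjI ballI)
      fix c assume "c \<in> I"
      then show "v c \<notin> span (insert (v n) U \<union> v ` {s \<in> S - {n}. c < s})"
        using nb[of c] unfolding eq[OF \<open>c \<in> I\<close>] by auto
    qed (use S in auto)
    moreover have "S = insert n (S - {n})" using True by auto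
    ultimately show ?thesis by blast
  qed
qed

lemma small_perturbation_keeps_signs:
  fixes v :: "nat \<Rightarrow> 'a::real_inner"
  assumes "finite I" "\<forall>i\<in>I. v i \<bullet> x \<noteq> 0"
  obtains e where "e > 0" "\<And>r i. \<bar>r\<bar> \<le> e \<Longrightarrow> i \<in> I \<Longrightarrow> sgn (v i \<bullet> (x + r *\<^sub>R w)) = sgn (v i \<bullet> x)"
proof -
  have "\<exists>e>0. \<forall>r i. \<bar>r\<bar> \<le> e \<longrightarrow> i \<in> I \<longrightarrow> sgn (v i \<bullet> (x + r *\<^sub>R w)) = sgn (v i \<bullet> x)"
    using assms
  proof (induction I rule: finite_induct)
    case empty
    then show ?case by (auto intro: exI[of _ 1])
  next
    case (insert k I)
    then obtain e where e: "e > 0" "\<And>r i. \<bar>r\<bar> \<le> e \<Longrightarrow> i \<in> I \<Longrightarrow> sgn (v i \<bullet> (x + r *\<^sub>R w)) = sgn (v i \<bullet> x)"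
      by auto
    define d where "d = \<bar>v k \<bullet> x\<bar> / (1 + \<bar>v k \<bullet> w\<bar>)"
    have k: "v k \<bullet> x \<noteq> 0" using insert by auto
    have d: "d > 0" unfolding d_def using k by (intro divide_pos_pos) auto
    have "sgn (v k \<bullet> (x + r *\<^sub>R w)) = sgn (v k \<bullet> x)" if "\<bar>r\<bar> \<le> d" for r
    proof -
      have "\<bar>r * (v k \<bullet> w)\<bar> \<le> d * \<bar>v k \<bullet> w\<bar>"
        using that by (simp add: abs_mult mult_right_mono)
      also have "\<dots> < d * (1 + \<bar>v k \<bullet> w\<bar>)" using d by (simp add: algebra_simps)
      also have "\<dots> = \<bar>v k \<bullet> x\<bar>" unfolding d_def by (simp add: add_nonneg_eq_0_iff)
      finally show ?thesis
        by (auto simp: inner_add_right sgn_if abs_if split: if_splits)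
    qed
    then show ?case using e d by (intro exI[of _ "min e d"]) auto
  qed
  then show ?thesis using that by blast
qed

text \<open>
  A new hyperplane cuts every old chamber that it meets into two, and the old chambers that it meets
  correspond to the chambers of the restriction to it.
\<close>

lemma chambers_insert:
  fixes v :: "nat \<Rightarrow> 'a::euclidean_space"
  assumes I: "finite I" and n: "n \<notin> I" and vn: "v n \<notin> span U"
  shows "card (chambers U v I) + card (chambers (insert (v n) U) v I) \<le> card (chambers U v (insert n I))"
proof -
  \<comment> \<open>Moving along \<open>w\<close> stays in \<open>U\<^sup>\<bottom>\<close> and crosses the new hyperplane.\<close>
  obtain y w where y: "y \<in> span U" and w: "\<And>u. u \<in> span U \<Longrightarrow> orthogonal w u" and yw: "v n = y + w"
    using orthogonal_subspace_decomp_exists[of U "v n"] by metis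
  have w0: "w \<noteq> 0" using vn y yw by auto
  have wU: "\<forall>u\<in>U. u \<bullet> w = 0"
    using w by (auto simp: orthogonal_def inner_commute span_base)
  have vnw: "v n \<bullet> w > 0"
    using w[OF y] w0 by (simp add: yw inner_add_left inner_add_right orthogonal_def inner_commute)
  let ?A = "chambers U v I" and ?B = "chambers (insert (v n) U) v I" and ?C = "chambers U v (insert n I)"
  have both: "s(n := 1) \<in> ?C \<and> s(n := -1) \<in> ?C" if sB: "s \<in> ?B" for s
  proof -
    obtain x where x: "\<forall>u\<in>U. u \<bullet> x = 0" "v n \<bullet> x = 0" "\<forall>i\<in>I. v i \<bullet> x \<noteq> 0" and s: "s = sign_pattern v I x"
      using sB unfolding chambers_def by blast
    obtain e where e: "e > 0" "\<And>r i. \<bar>r\<bar> \<le> e \<Longrightarrow> i \<in> I \<Longrightarrow> sgn (v i \<bullet> (x + r *\<^sub>R w)) = sgn (v i \<bullet> x)"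
      using small_perturbation_keeps_signs[OF I x(3), of w] by blast
    have "s(n := sgn r) \<in> ?C" if r: "\<bar>r\<bar> = e" for r
    proof -
      have r0: "r \<noteq> 0" and re: "\<bar>r\<bar> \<le> e" using r e by auto
      have "s(n := sgn r) = sign_pattern v (insert n I) (x + r *\<^sub>R w)"
      proof
        fix i
        show "(s(n := sgn r)) i = sign_pattern v (insert n I) (x + r *\<^sub>R w) i"
          using e(2)[OF re, of i] n x(2) vnw
          by (auto simp: s sign_pattern_def inner_add_right sgn_mult)
      qed
      moreover have "\<forall>i\<in>insert n I. v i \<bullet> (x + r *\<^sub>R w) \<noteq> 0"
      proof
        fix i assume i: "i \<in> insert n I"
        show "v i \<bullet> (x + r *\<^sub>R w) \<noteq> 0"
        proof (cases "i = n")
          case True then show ?thesis using x(2) vnw r0 by (simp add: inner_add_right)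
        next
          case False
          then show ?thesis using e(2)[OF re, of i] x(3) i by (metis insertE sgn_zero_iff)
        qed
      qed
      moreover have "\<forall>u\<in>U. u \<bullet> (x + r *\<^sub>R w) = 0" using x wU by (simp add: inner_add_right)
      ultimately show ?thesis unfolding chambers_def by blast
    qed
    from this[of e] this[of "-e"] e(1) show ?thesis by simp
  qed
  have one: "s(n := 1) \<in> ?C \<or> s(n := -1) \<in> ?C" if sA: "s \<in> ?A" for s
  proof -
    obtain x where x: "\<forall>u\<in>U. u \<bullet> x = 0" "\<forall>i\<in>I. v i \<bullet> x \<noteq> 0" and s: "s = sign_pattern v I x"
      using sA unfolding chambers_def by blast
    show ?thesis
    proof (cases "v n \<bullet> x = 0")
      case True
      then have "s \<in> ?B" unfolding chambers_def s using x by auto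
      then show ?thesis using both by blast
    next
      case False
      have "s(n := sgn (v n \<bullet> x)) = sign_pattern v (insert n I) x"
        by (auto simp: s sign_pattern_def)
      then have "s(n := sgn (v n \<bullet> x)) \<in> ?C" unfolding chambers_def using x False by auto
      then show ?thesis using False by (auto simp: sgn_if split: if_splits)
    qed
  qed
  \<comment> \<open>\<open>g s\<close> is one sign that extends \<open>s\<close>; for a chamber that the hyperplane meets, \<open>- g s\<close> extends \<open>s\<close> too.\<close>
  define g where "g s = (if s(n := 1) \<in> ?C then 1 else - 1 :: real)" for s
  have off: "s n = 0" if "s \<in> ?A \<union> ?B" for s
    using that n by (auto simp: chambers_def sign_pattern_def)
  have inj: "s = t \<and> a = b" if "s \<in> ?A \<union> ?B" "t \<in> ?A \<union> ?B" "s(n := a) = t(n := b)" for s t and a b :: real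
    using off[OF that(1)] off[OF that(2)] that(3) by (metis fun_upd_triv fun_upd_upd fun_upd_same)
  let ?f = "\<lambda>s. s(n := g s)" and ?h = "\<lambda>s. s(n := - g s)"
  have "?f s \<in> ?C" if "s \<in> ?A" for s
    using one[OF that] by (cases "s(n := 1) \<in> ?C") (simp_all add: g_def)
  then have "?f ` ?A \<subseteq> ?C" by blast
  moreover have "?h s \<in> ?C" if "s \<in> ?B" for s
    using both[OF that] by (cases "s(n := 1) \<in> ?C") (simp_all add: g_def)
  then have "?h ` ?B \<subseteq> ?C" by blast
  moreover have "?f ` ?A \<inter> ?h ` ?B = {}"
  proof -
    have "?f s \<noteq> ?h t" if "s \<in> ?A" "t \<in> ?B" for s t
    proof
      assume "?f s = ?h t"
      then have "s = t \<and> g s = - g t" using inj[of s t] that by blast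
      then show False by (auto simp: g_def split: if_splits)
    qed
    then show ?thesis by blast
  qed
  moreover have "finite ?A" "finite ?B" "finite ?C" using I by (simp_all add: finite_chambers)
  ultimately have "card (?f ` ?A) + card (?h ` ?B) \<le> card ?C"
    using card_mono[of ?C "?f ` ?A \<union> ?h ` ?B"] by (simp add: card_Un_disjoint)
  moreover have "card (?f ` ?A) = card ?A"
  proof (rule card_image, rule inj_onI)
    fix s t assume "s \<in> ?A" "t \<in> ?A" "?f s = ?f t"
    then show "s = t" using inj[of s t] by blast
  qed
  moreover have "card (?h ` ?B) = card ?B"
  proof (rule card_image, rule inj_onI)
    fix s t assume "s \<in> ?B" "t \<in> ?B" "?h s = ?h t"
    then show "s = t" using inj[of s t] by blast
  qed
  ultimately show ?thesis by simp
qed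

text \<open>
  Deletion and contraction bound the one number from above by the same sum that bounds the other
  from below.  If \<open>v n\<close> is in the span of \<open>U\<close>, the induction stops, since then no set is free of broken circuits.
\<close>

lemma card_nbc_le_card_chambers:
  fixes v :: "nat \<Rightarrow> 'a::euclidean_space"
  assumes "finite I"
  shows "card {S. no_broken_circuit U v I S} \<le> card (chambers U v I)"
  using assms
proof (induction I arbitrary: U rule: finite_linorder_max_induct)
  case empty
  have "{S. no_broken_circuit U v {} S} = {{}}" by (auto simp: no_broken_circuit_def)
  moreover have "sign_pattern v {} 0 \<in> chambers U v {}" unfolding chambers_def by (rule imageI) auto
  then have "card (chambers U v {}) > 0" using finite_chambers[of "{}" U v] by (auto simp: card_gt_0_iff)
  ultimately show ?case by simp
next
  case (insert n I)
  have n: "n \<notin> I" using insert by auto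
  have fin: "finite {S. no_broken_circuit V v I S}" for V
    by (rule finite_subset[of _ "Pow I"]) (use insert in \<open>auto simp: no_broken_circuit_def\<close>)
  show ?case
  proof (cases "v n \<in> span U")
    case True
    then have "{S. no_broken_circuit U v (insert n I) S} = {}"
      using span_mono[of U "U \<union> X" for X] by (fastforce simp: no_broken_circuit_def)
    then show ?thesis by (simp only: card.empty)
  next
    case False
    have "card {S. no_broken_circuit U v (insert n I) S} \<le>
      card ({S. no_broken_circuit U v I S} \<union> insert n ` {S. no_broken_circuit (insert (v n) U) v I S})"
      using nbc_insert_max[of I n U v] insert fin by (intro card_mono) auto
    also have "\<dots> \<le> card {S. no_broken_circuit U v I S} + card (insert n ` {S. no_broken_circuit (insert (v n) U) v I S})"
      by (rule card_Un_le)
    also have "\<dots> \<le> card {S. no_broken_circuit U v I S} + card {S. no_broken_circuit (insert (v n) U) v I S}"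
      by (simp add: card_image_le fin)
    also have "\<dots> \<le> card (chambers U v I) + card (chambers (insert (v n) U) v I)"
      by (intro add_mono insert.IH)
    also have "\<dots> \<le> card (chambers U v (insert n I))"
      using chambers_insert[of I n v U] insert n False by blast
    finally show ?thesis .
  qed
qed

section \<open>Products of reciprocals of linear forms\<close>

text \<open>
  Real functions on a set are compared by dimension, so they are made a vector space with
  pointwise operations.
\<close>

interpretation fun_space: vector_space "\<lambda>(c::real) (f::'a \<Rightarrow> real) x. c * f x"
  by unfold_locales (auto simp: algebra_simps fun_eq_iff)

lemma sum_fun_apply: "(\<Sum>i\<in>A. f i) x = (\<Sum>i\<in>A. f i x)" for f :: "'i \<Rightarrow> 'a \<Rightarrow> real"
  by (induction A rule: infinite_finite_induct) auto

text \<open>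
  The product is cut off outside \<open>X\<close>, so that equality of functions means equality on \<open>X\<close>.
\<close>

definition recip_monomial :: "'a set \<Rightarrow> (nat \<Rightarrow> 'a::real_inner) \<Rightarrow> nat set \<Rightarrow> 'a \<Rightarrow> real" where
  "recip_monomial X v S x = (if x \<in> X then \<Prod>s\<in>S. inverse (v s \<bullet> x) else 0)"

text \<open>
  If \<open>S\<close> contains the broken circuit belonging to \<open>c\<close>, then \<open>\<langle>v c, x\<rangle> = \<Sum>\<^sub>s a\<^sub>s \<langle>v s, x\<rangle>\<close> over some
  \<open>s \<in> S\<close> larger than \<open>c\<close>.  Dividing by \<open>\<langle>v c, x\<rangle>\<close> and by all \<open>\<langle>v s, x\<rangle>\<close> with \<open>s \<in> S\<close> replaces the product over
  \<open>S\<close> by products over the exchanged sets \<open>S - {s} \<union> {c}\<close>.  They have the same size, are still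
  independent where \<open>a\<^sub>s \<noteq> 0\<close>, and have a smaller sum of elements, so the exchange terminates.
\<close>

lemma recip_monomial_in_nbc_span:
  fixes v :: "nat \<Rightarrow> 'a::euclidean_space"
  assumes J: "finite J" and inj: "inj_on v J" and X: "\<And>x j. x \<in> X \<Longrightarrow> j \<in> J \<Longrightarrow> v j \<bullet> x \<noteq> 0"
    and "S \<subseteq> J" "independent (v ` S)"
  shows "recip_monomial X v S \<in>
    fun_space.span (recip_monomial X v ` {B. no_broken_circuit {} v J B \<and> card B = card S})"
  using assms(4,5)
proof (induction "\<Sum>S" arbitrary: S rule: less_induct)
  case less
  show ?case
  proof (cases "no_broken_circuit {} v J S")
    case True
    then show ?thesis by (intro fun_space.span_base) auto
  next
    case False
    have finS: "finite S" using less J finite_subset by blast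
    have injS: "inj_on v S" using less inj inj_on_subset by blast
    obtain c where c: "c \<in> J" "v c \<in> span (v ` {s\<in>S. c < s})"
      using False less by (auto simp: no_broken_circuit_def)
    define T where "T = {s\<in>S. c < s}"
    have T: "T \<subseteq> S" "finite T" using finS by (auto simp: T_def)
    have injT: "inj_on v T" using injS T inj_on_subset by blast
    have "c \<notin> S"
    proof
      assume "c \<in> S"
      have "v ` T \<subseteq> v ` S - {v c}"
        using injS \<open>c \<in> S\<close> by (auto simp: T_def inj_on_def)
      then have "v c \<in> span (v ` S - {v c})" using c span_mono unfolding T_def by blast
      then show False using less.prems \<open>c \<in> S\<close> by (auto simp: dependent_def)
    qed
    obtain b where b: "v c = (\<Sum>y\<in>v ` T. b y *\<^sub>R y)"
      using c(2) T unfolding T_def[symmetric] by (auto simp: span_finite)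
    define a where "a s = b (v s)" for s
    have vc: "v c = (\<Sum>s\<in>T. a s *\<^sub>R v s)"
      unfolding b a_def by (rule sum.reindex_cong[OF injT]) auto
    let ?S = "\<lambda>s. insert c (S - {s})"
    \<comment> \<open>The exchange relation obtained from the circuit.\<close>
    have "recip_monomial X v S = (\<Sum>s\<in>T. (\<lambda>x. a s * recip_monomial X v (?S s) x))"
    proof
      fix x
      have "recip_monomial X v S x = (\<Sum>s\<in>T. a s * recip_monomial X v (?S s) x)"
      proof (cases "x \<in> X")
        case True
        have nz: "v c \<bullet> x \<noteq> 0" using X True c by auto
        have "(\<Prod>s\<in>S. inverse (v s \<bullet> x)) = inverse (v c \<bullet> x) * (v c \<bullet> x) * (\<Prod>s\<in>S. inverse (v s \<bullet> x))"
          using nz by simp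
        also have "v c \<bullet> x = (\<Sum>s\<in>T. a s * (v s \<bullet> x))"
          by (subst vc) (simp add: inner_sum_left)
        also have "inverse (\<Sum>s\<in>T. a s * (v s \<bullet> x)) * (\<Sum>s\<in>T. a s * (v s \<bullet> x)) * (\<Prod>s\<in>S. inverse (v s \<bullet> x))
          = (\<Sum>s\<in>T. a s * (inverse (v c \<bullet> x) * ((v s \<bullet> x) * (\<Prod>s\<in>S. inverse (v s \<bullet> x)))))"
          unfolding \<open>v c \<bullet> x = (\<Sum>s\<in>T. a s * (v s \<bullet> x))\<close>[symmetric]
          by (subst \<open>v c \<bullet> x = (\<Sum>s\<in>T. a s * (v s \<bullet> x))\<close>) (simp add: sum_distrib_left sum_distrib_right mult_ac)
        also have "\<dots> = (\<Sum>s\<in>T. a s * (\<Prod>s\<in>?S s. inverse (v s \<bullet> x)))"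
        proof (rule sum.cong)
          fix s assume s: "s \<in> T"
          then have "s \<in> S" "v s \<bullet> x \<noteq> 0" using T X True less.prems by blast+
          then have "(v s \<bullet> x) * (\<Prod>s\<in>S. inverse (v s \<bullet> x)) = (\<Prod>s\<in>S - {s}. inverse (v s \<bullet> x))"
            using finS by (simp add: prod.remove)
          then show "a s * (inverse (v c \<bullet> x) * ((v s \<bullet> x) * (\<Prod>s\<in>S. inverse (v s \<bullet> x)))) =
              a s * (\<Prod>s\<in>?S s. inverse (v s \<bullet> x))"
            using finS \<open>c \<notin> S\<close> by simp
        qed simp
        finally show ?thesis using True by (simp add: recip_monomial_def)
      qed (simp add: recip_monomial_def)
      then show "recip_monomial X v S x = (\<Sum>s\<in>T. (\<lambda>x. a s * recip_monomial X v (?S s) x)) x"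
        by (simp add: sum_fun_apply)
    qed
    moreover have "(\<lambda>x. a s * recip_monomial X v (?S s) x) \<in>
      fun_space.span (recip_monomial X v ` {B. no_broken_circuit {} v J B \<and> card B = card S})" if s: "s \<in> T" for s
    proof (cases "a s = 0")
      case True
      have "(\<lambda>x. a s * recip_monomial X v (?S s) x) = 0" using True by (auto simp: fun_eq_iff)
      then show ?thesis using fun_space.span_zero by metis
    next
      case False
      have sS: "s \<in> S" "c < s" using s by (auto simp: T_def)
      have ind: "independent (v ` (S - {s}))"
        using less.prems(2) independent_mono by (metis Diff_subset image_mono)
      have "v c \<notin> span (v ` (S - {s}))"
      proof
        assume vcs: "v c \<in> span (v ` (S - {s}))"
        have "(\<Sum>r\<in>T - {s}. a r *\<^sub>R v r) \<in> span (v ` (S - {s}))"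
          using T by (intro span_sum span_scale span_base) auto
        then have "v c - (\<Sum>r\<in>T - {s}. a r *\<^sub>R v r) \<in> span (v ` (S - {s}))"
          using vcs span_diff by blast
        moreover have "v c - (\<Sum>r\<in>T - {s}. a r *\<^sub>R v r) = a s *\<^sub>R v s"
          using vc T s by (simp add: sum.remove)
        ultimately have "a s *\<^sub>R v s \<in> span (v ` (S - {s}))" by simp
        then have "inverse (a s) *\<^sub>R (a s *\<^sub>R v s) \<in> span (v ` (S - {s}))" by (rule span_scale)
        then have "v s \<in> span (v ` (S - {s}))" using False by simp
        moreover have "v ` (S - {s}) = v ` S - {v s}"
          using injS sS by (auto simp: inj_on_def)
        ultimately show False using less.prems(2) sS by (auto simp: dependent_def)
      qed
      then have "independent (v ` ?S s)" using ind by (simp add: independent_insert)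
      moreover have "\<Sum>(?S s) < \<Sum>S"
        using finS sS \<open>c \<notin> S\<close> by (simp add: sum.remove[of S s])
      moreover have "?S s \<subseteq> J" using less.prems c by auto
      moreover have "card (?S s) = card S"
        using finS sS \<open>c \<notin> S\<close> by (metis card.remove card_insert_disjoint finite_Diff DiffD1)
      ultimately have "recip_monomial X v (?S s) \<in>
        fun_space.span (recip_monomial X v ` {B. no_broken_circuit {} v J B \<and> card B = card S})"
        using less.hyps[of "?S s"] by simp
      then show ?thesis by (rule fun_space.span_scale)
    qed
    ultimately show ?thesis by (auto intro: fun_space.span_sum)
  qed
qed

section \<open>Determinants of sums of rank-one matrices\<close>

abbreviation rank_one_perturbation :: "nat set \<Rightarrow> (nat \<Rightarrow> real) \<Rightarrow> (nat \<Rightarrow> real^'d) \<Rightarrow> real^'d^'d" where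
  "rank_one_perturbation J a v \<equiv> mat 1 + (\<Sum>j\<in>J. a j *\<^sub>R outer_product (v j) (v j))"

lemma rank_one_perturbation_mult:
  fixes x :: "real^'d"
  shows
  "rank_one_perturbation J a v *v x = x + (\<Sum>j\<in>J. (a j * (v j \<bullet> x)) *\<^sub>R v j)"
proof -
  have "outer_product u u *v x = (u \<bullet> x) *\<^sub>R u" for u
    by (simp add: vec_eq_iff matrix_vector_mult_def outer_product_def inner_vec_def sum_distrib_left
        sum_distrib_right mult_ac)
  then have "(\<Sum>j\<in>J. a j *\<^sub>R outer_product (v j) (v j)) *v x = (\<Sum>j\<in>J. (a j * (v j \<bullet> x)) *\<^sub>R v j)"
    by (induction J rule: infinite_finite_induct)
      (simp_all add: matrix_vector_mult_add_rdistrib flip: scaleR_matrix_vector_assoc)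
  then show ?thesis by (simp add: matrix_vector_mult_add_rdistrib)
qed

text \<open>
  The matrix is positive definite, and so are those on the segment from it to the identity.  Hence the
  determinant does not vanish on that segment and keeps the sign of \<open>det 1 = 1\<close>.
\<close>

lemma det_rank_one_perturbation_pos:
  assumes "\<And>j. j \<in> J \<Longrightarrow> a j \<ge> 0"
  shows "det (rank_one_perturbation J a v) > 0"
proof -
  define f where "f s = det (rank_one_perturbation J (\<lambda>j. s * a j) v)" for s
  have nz: "f s \<noteq> 0" if "s \<ge> 0" for s
  proof -
    let ?A = "rank_one_perturbation J (\<lambda>j. s * a j) v"
    have "x = 0" if x: "?A *v x = 0" for x
    proof -
      have "0 \<le> (\<Sum>j\<in>J. s * a j * (v j \<bullet> x)\<^sup>2)"
        using assms \<open>s \<ge> 0\<close> by (intro sum_nonneg) auto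
      moreover have eq: "x \<bullet> (?A *v x) = x \<bullet> x + (\<Sum>j\<in>J. s * a j * (v j \<bullet> x)\<^sup>2)"
        unfolding rank_one_perturbation_mult
        by (simp add: inner_add_right inner_sum_right power2_eq_square inner_commute mult_ac)
      ultimately have "x \<bullet> x = 0" using eq[unfolded x inner_zero_right] inner_ge_zero[of x] by linarith
      then show "x = 0" by simp
    qed
    then have "invertible ?A"
      using matrix_left_invertible_ker[of ?A] by (auto simp: invertible_left_inverse)
    then show ?thesis by (simp add: f_def invertible_det_nz)
  qed
  have "continuous_on {0..1} f"
    unfolding f_def det_def by (intro continuous_intros)
  moreover have f0: "f 0 = 1" by (simp add: f_def)
  ultimately have "f 1 > 0"
    using IVT2'[of f 1 0 0] nz by (force simp: not_less)
  then show ?thesis by (simp add: f_def)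
qed

lemma det_sum_of_rows:
  fixes r :: "'d::finite \<Rightarrow> 'i \<Rightarrow> real^'d"
  assumes "finite K"
  shows "det (\<chi> i. \<Sum>k\<in>K. r i k) = (\<Sum>f\<in>UNIV \<rightarrow>\<^sub>E K. det (\<chi> i. r i (f i)))"
proof -
  have "det (\<chi> i. \<Sum>k\<in>K. r i k) =
      (\<Sum>p | p permutes UNIV. of_int (sign p) * (\<Prod>i\<in>UNIV. \<Sum>k\<in>K. r i k $ p i))"
    by (simp add: det_def)
  also have "\<dots> = (\<Sum>p | p permutes UNIV. \<Sum>f\<in>UNIV \<rightarrow>\<^sub>E K. of_int (sign p) * (\<Prod>i\<in>UNIV. r i (f i) $ p i))"
    using assms by (simp add: prod_sum_PiE sum_distrib_left)
  also have "\<dots> = (\<Sum>f\<in>UNIV \<rightarrow>\<^sub>E K. det (\<chi> i. r i (f i)))"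
    by (subst sum.swap) (simp add: det_def)
  finally show ?thesis .
qed

text \<open>
  Row \<open>i\<close> of the matrix \<open>I + \<Sum>\<^sub>j a\<^sub>j v\<^sub>j v\<^sub>j\<^sup>T\<close> is a sum of multiples of the unit vector \<open>e\<^sub>i\<close>, indexed by
  \<open>None\<close>, and of the \<open>v\<^sub>j\<close>, indexed by \<open>Some j\<close>.  Expanding the determinant by rows amounts to picking one
  summand \<open>f i\<close> for each \<open>i\<close>.
\<close>

definition picked_row :: "(nat \<Rightarrow> real^'d) \<Rightarrow> 'd \<Rightarrow> nat option \<Rightarrow> real^'d" where
  "picked_row v i k = (case k of None \<Rightarrow> axis i 1 | Some j \<Rightarrow> v j)"

definition picked_weight :: "(nat \<Rightarrow> real^'d) \<Rightarrow> ('d \<Rightarrow> nat option) \<Rightarrow> real" where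
  "picked_weight v f = (\<Prod>i\<in>UNIV. case f i of None \<Rightarrow> 1 | Some j \<Rightarrow> v j $ i)"

definition picked_indices :: "('d \<Rightarrow> nat option) \<Rightarrow> nat set" where
  "picked_indices f = {j. Some j \<in> range f}"

text \<open>
  By the Cauchy-Binet formula this is the Gram determinant of \<open>(v\<^sub>j)\<^sub>j\<^sub>\<in>\<^sub>S\<close>.  It is computed below only for
  \<open>|S| \<le> 1\<close> and for dependent \<open>S\<close>.
\<close>

definition minor_coeff :: "nat set \<Rightarrow> (nat \<Rightarrow> real^'d) \<Rightarrow> nat set \<Rightarrow> real" where
  "minor_coeff J v S = (\<Sum>f | f \<in> UNIV \<rightarrow>\<^sub>E insert None (Some ` J) \<and> picked_indices f = S.
      picked_weight v f * det (\<chi> i. picked_row v i (f i)))"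

lemma det_picked_rows_noninjective:
  fixes f :: "'d::finite \<Rightarrow> nat option"
  assumes "i \<noteq> k" "f i = f k" "f i \<noteq> None"
  shows "det (\<chi> i. picked_row v i (f i)) = 0"
  by (rule det_identical_rows[OF assms(1)]) (use assms in \<open>auto simp: row_def picked_row_def split: option.split\<close>)

text \<open>
  Only choices of rows that pick no \<open>j\<close> twice contribute, so every \<open>a\<^sub>j\<close> occurs to a power at
  most \<open>1\<close> and the choices can be grouped by the set of indices that they pick.
\<close>

lemma det_rank_one_perturbation:
  fixes v :: "nat \<Rightarrow> real^'d"
  assumes J: "finite J"
  shows "det (rank_one_perturbation J a v) = (\<Sum>S\<in>Pow J. minor_coeff J v S * (\<Prod>j\<in>S. a j))"
proof -
  let ?O = "insert None (Some ` J)" and ?K = "\<lambda>f. det (\<chi> i. picked_row v i (f i))"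
  let ?F = "(UNIV :: 'd set) \<rightarrow>\<^sub>E ?O"
  let ?c = "\<lambda>i k. case k of None \<Rightarrow> 1 | Some j \<Rightarrow> a j * v j $ i"
  have finF: "finite ?F" using J by (intro finite_PiE) auto
  have "rank_one_perturbation J a v = (\<chi> i. \<Sum>k\<in>?O. ?c i k *s picked_row v i k)"
    using J by (simp add: vec_eq_iff mat_def axis_def outer_product_def picked_row_def sum.reindex sum_distrib_left mult_ac)
  then have "det (rank_one_perturbation J a v) = (\<Sum>f\<in>?F. det (\<chi> i. ?c i (f i) *s picked_row v i (f i)))"
    using J by (simp only: det_sum_of_rows finite_insert finite_imageI)
  also have "\<dots> = (\<Sum>f\<in>?F. (\<Prod>i\<in>UNIV. ?c i (f i)) * ?K f)"
    by (simp only: det_rows_mul)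
  also have "\<dots> = (\<Sum>f\<in>?F. (\<Prod>j\<in>picked_indices f. a j) * (picked_weight v f * ?K f))"
  proof (rule sum.cong)
    fix f :: "'d \<Rightarrow> nat option"
    show "(\<Prod>i\<in>UNIV. ?c i (f i)) * ?K f = (\<Prod>j\<in>picked_indices f. a j) * (picked_weight v f * ?K f)"
    proof (cases "?K f = 0")
      case False
      \<comment> \<open>A choice with nonzero determinant picks each index at most once.\<close>
      then have inj: "inj_on (\<lambda>i. the (f i)) {i. f i \<noteq> None}"
        using det_picked_rows_noninjective[of _ _ f v] by (fastforce simp: inj_on_def)
      have "?c i (f i) = (case f i of None \<Rightarrow> 1 | Some j \<Rightarrow> a j) * (case f i of None \<Rightarrow> 1 | Some j \<Rightarrow> v j $ i)" for i
        by (simp split: option.split)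
      then have "(\<Prod>i\<in>UNIV. ?c i (f i)) = (\<Prod>i\<in>UNIV. case f i of None \<Rightarrow> 1 | Some j \<Rightarrow> a j) * picked_weight v f"
        by (simp only: picked_weight_def prod.distrib)
      also have "(\<Prod>i\<in>UNIV. case f i of None \<Rightarrow> 1 | Some j \<Rightarrow> a j) = (\<Prod>i | f i \<noteq> None. a (the (f i)))"
        by (rule prod.mono_neutral_cong_right) auto
      also have "\<dots> = (\<Prod>j\<in>(\<lambda>i. the (f i)) ` {i. f i \<noteq> None}. a j)"
        by (rule prod.reindex[OF inj, symmetric, unfolded o_def])
      also have "(\<lambda>i. the (f i)) ` {i. f i \<noteq> None} = picked_indices f"
      proof (intro set_eqI iffI)
        fix j assume "j \<in> (\<lambda>i. the (f i)) ` {i. f i \<noteq> None}"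
        then obtain i where "f i \<noteq> None" "j = the (f i)" by blast
        then have "Some j = f i" by simp
        then show "j \<in> picked_indices f" unfolding picked_indices_def by blast
      next
        fix j assume "j \<in> picked_indices f"
        then obtain i where "Some j = f i" unfolding picked_indices_def by blast
        then have "f i \<noteq> None" "j = the (f i)" by (metis option.distinct(1), metis option.sel)
        then show "j \<in> (\<lambda>i. the (f i)) ` {i. f i \<noteq> None}" by blast
      qed
      finally show ?thesis by simp
    qed simp
  qed simp
  also have "\<dots> = (\<Sum>S\<in>Pow J. \<Sum>f | f \<in> ?F \<and> picked_indices f = S.
      (\<Prod>j\<in>picked_indices f. a j) * (picked_weight v f * ?K f))"
  proof (rule sum.group[symmetric, OF finF])
    show "picked_indices ` ?F \<subseteq> Pow J"
    proof (intro image_subsetI PowI subsetI)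
      fix f :: "'d \<Rightarrow> nat option" and j assume f: "f \<in> ?F" and "j \<in> picked_indices f"
      then obtain i where "Some j = f i" unfolding picked_indices_def by blast
      moreover have "f i \<in> insert None (Some ` J)" using f by (rule PiE_mem) simp
      ultimately show "j \<in> J" by auto
    qed
  qed (use J in simp)
  also have "\<dots> = (\<Sum>S\<in>Pow J. minor_coeff J v S * (\<Prod>j\<in>S. a j))"
    by (auto intro!: sum.cong simp: minor_coeff_def sum_distrib_left mult_ac)
  finally show ?thesis .
qed

lemma minor_coeff_empty:
  fixes v :: "nat \<Rightarrow> real^'d"
  shows "minor_coeff J v {} = 1"
proof -
  have *: "{f. f \<in> (UNIV :: 'd set) \<rightarrow>\<^sub>E insert None (Some ` J) \<and> picked_indices f = {}} = {\<lambda>_. None}"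
    by (auto simp: picked_indices_def PiE_def Pi_def fun_eq_iff)
      (metis not_None_eq rangeI)
  have "(\<chi> i. axis i 1) = (mat 1 :: real^'d^'d)"
    by (simp add: vec_eq_iff mat_def axis_def)
  then show ?thesis
    unfolding minor_coeff_def * by (simp add: picked_weight_def picked_row_def)
qed

text \<open>
  The contributing choices pick \<open>j\<close> in one row \<open>k\<close> only, and the identity matrix with row \<open>k\<close> replaced
  by \<open>v j\<close> has determinant \<open>v j $ k\<close>.
\<close>

lemma minor_coeff_singleton:
  fixes v :: "nat \<Rightarrow> real^'d"
  assumes J: "finite J" "j \<in> J"
  shows "minor_coeff J v {j} = v j \<bullet> v j"
proof -
  let ?F = "{f. f \<in> (UNIV :: 'd set) \<rightarrow>\<^sub>E insert None (Some ` J) \<and> picked_indices f = {j}}"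
  let ?t = "\<lambda>f. picked_weight v f * det (\<chi> i. picked_row v i (f i))"
  let ?g = "\<lambda>k. (\<lambda>_. None)(k := Some j) :: 'd \<Rightarrow> nat option"
  have "finite ?F" by (rule finite_subset[OF _ finite_PiE[of UNIV "\<lambda>_. insert None (Some ` J)"]]) (use J in auto)
  then have "minor_coeff J v {j} = sum ?t (range ?g)"
    unfolding minor_coeff_def
  proof (rule sum.mono_neutral_right)
    show "range ?g \<subseteq> ?F" using J by (auto simp: picked_indices_def image_iff split: if_splits)
    show "\<forall>f\<in>?F - range ?g. ?t f = 0"
    proof
      fix f assume f: "f \<in> ?F - range ?g"
      then have j: "{j'. Some j' \<in> range f} = {j}" by (simp add: picked_indices_def)
      then have "j \<in> {j'. Some j' \<in> range f}" by simp
      then obtain k where "Some j = f k" by blast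
      then have k: "f k = Some j" by simp
      from f have "f \<noteq> ?g k" by blast
      then obtain i where i: "f i \<noteq> ?g k i" by (auto simp: fun_eq_iff)
      then have "i \<noteq> k" using k by auto
      then obtain j' where "f i = Some j'" using i by auto
      then have j': "Some j' = f i" by simp
      then have "j' \<in> {j'. Some j' \<in> range f}" by blast
      then have "f i = Some j" using j j' by simp
      then show "?t f = 0" using det_picked_rows_noninjective[OF \<open>i \<noteq> k\<close>, of f v] k by simp
    qed
  qed
  also have "\<dots> = (\<Sum>k\<in>UNIV. ?t (?g k))"
    by (rule sum.reindex_cong[where l = ?g]) (auto simp: inj_on_def fun_eq_iff split: if_splits)
  also have "\<dots> = (\<Sum>k\<in>UNIV. v j $ k * v j $ k)"
  proof (rule sum.cong)
    fix k :: 'd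
    have "picked_weight v (?g k) = (\<Prod>i\<in>UNIV. if i = k then v j $ i else 1)"
      unfolding picked_weight_def by (rule prod.cong) auto
    then have "picked_weight v (?g k) = v j $ k" by simp
    moreover have "(\<chi> i. picked_row v i (?g k i)) = (\<chi> i. if i = k then v j else row i (mat 1 :: real^'d^'d))"
      by (auto simp: vec_eq_iff picked_row_def row_def mat_def axis_def)
    moreover have "v j = (\<Sum>i\<in>UNIV. v j $ i *s row i (mat 1 :: real^'d^'d))"
      by (simp add: vec_eq_iff row_def mat_def if_distrib[of "(*) _"] cong: if_cong)
    ultimately show "?t (?g k) = v j $ k * v j $ k"
      using cramer_lemma_transpose[of k "v j" "mat 1 :: real^'d^'d"] by (simp only: det_I mult_1_right)
  qed simp
  finally show ?thesis by (simp add: inner_vec_def)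
qed

text \<open>
  All \<open>v j\<close> with \<open>j \<in> S\<close> occur as rows in each of the determinants.
\<close>

lemma minor_coeff_dependent:
  fixes v :: "nat \<Rightarrow> real^'d"
  assumes "dependent (v ` S)"
  shows "minor_coeff J v S = 0"
  unfolding minor_coeff_def
proof (rule sum.neutral, rule ballI)
  fix f :: "'d \<Rightarrow> nat option" assume "f \<in> {f. f \<in> UNIV \<rightarrow>\<^sub>E insert None (Some ` J) \<and> picked_indices f = S}"
  then have S: "S = {j. Some j \<in> range f}" by (auto simp: picked_indices_def)
  have "v ` S \<subseteq> rows (\<chi> i. picked_row v i (f i))"
  proof
    fix y assume "y \<in> v ` S"
    then obtain i j where "Some j = f i" "y = v j" unfolding S by blast
    then have "f i = Some j" "y = v j" by simp_all
    then have "y = row i (\<chi> i. picked_row v i (f i))" by (simp add: row_def picked_row_def)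
    then show "y \<in> rows (\<chi> i. picked_row v i (f i))" by (auto simp: rows_def)
  qed
  then have "dependent (rows (\<chi> i. picked_row v i (f i)))"
    using assms dependent_mono by blast
  then show "picked_weight v f * det (\<chi> i. picked_row v i (f i)) = 0"
    by (simp add: det_dependent_rows dependent_vec_eq)
qed

section \<open>Critical points and chambers\<close>

definition critical_points :: "nat set \<Rightarrow> (nat \<Rightarrow> 'a::real_inner) \<Rightarrow> 'a set" where
  "critical_points J v =
    {x. (\<forall>j\<in>J. v j \<bullet> x \<noteq> 0) \<and> (\<Sum>j\<in>J. inverse (v j \<bullet> x) *\<^sub>R v j) = real (card J) *\<^sub>R x}"

text \<open>
  The inner product of the critical equation with \<open>x\<close> reads \<open>n = n \<langle>x, x\<rangle>\<close>.
\<close>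

lemma norm_critical_point:
  assumes "finite J" "J \<noteq> {}" "x \<in> critical_points J v"
  shows "norm x = 1"
proof -
  have "(\<Sum>j\<in>J. inverse (v j \<bullet> x) * (v j \<bullet> x)) = (\<Sum>j\<in>J. inverse (v j \<bullet> x) *\<^sub>R v j) \<bullet> x"
    by (simp add: inner_sum_left)
  also have "\<dots> = real (card J) * (x \<bullet> x)"
    using assms(3) by (simp add: critical_points_def)
  also have "(\<Sum>j\<in>J. inverse (v j \<bullet> x) * (v j \<bullet> x)) = real (card J)"
    using assms(3) by (simp add: critical_points_def)
  finally have "x \<bullet> x = 1" using assms by simp
  then show ?thesis by (simp add: norm_eq_1)
qed

text \<open>
  The gradient is \<open>P(u) \<Sum>\<^sub>j v\<^sub>j / \<langle>v\<^sub>j, u\<rangle>\<close>.  If it is \<open>c u\<close>, then the inner product with \<open>u\<close> gives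
  \<open>c = n P(u)\<close>, which is Euler's identity for the homogeneous polynomial \<open>P\<close>.
\<close>

lemma sphere_extrema_eq_critical_points:
  fixes v :: "nat \<Rightarrow> real^'d"
  assumes "n \<ge> 1"
  shows "sphere_extrema (prod_linear_forms n v) = critical_points {1..n} v"
proof -
  let ?P = "prod_linear_forms n v" and ?J = "{1..n}"
  have grad: "GDERIV ?P u :> (?P u *\<^sub>R (\<Sum>j\<in>?J. inverse (v j \<bullet> u) *\<^sub>R v j))" if u: "\<forall>j\<in>?J. v j \<bullet> u \<noteq> 0" for u
  proof -
    have "(?P has_derivative (\<lambda>h. \<Sum>j\<in>?J. (v j \<bullet> h) * (\<Prod>i\<in>?J - {j}. v i \<bullet> u))) (at u)"
      unfolding prod_linear_forms_def by (rule has_derivative_prod) (auto intro!: derivative_eq_intros)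
    moreover have "(\<lambda>h. \<Sum>j\<in>?J. (v j \<bullet> h) * (\<Prod>i\<in>?J - {j}. v i \<bullet> u))
        = (\<lambda>h. h \<bullet> (?P u *\<^sub>R (\<Sum>j\<in>?J. inverse (v j \<bullet> u) *\<^sub>R v j)))"
    proof
      fix h
      have "h \<bullet> (?P u *\<^sub>R (\<Sum>j\<in>?J. inverse (v j \<bullet> u) *\<^sub>R v j))
          = (\<Sum>j\<in>?J. (v j \<bullet> h) * (?P u * inverse (v j \<bullet> u)))"
        by (simp add: inner_sum_right sum_distrib_left inner_commute mult_ac)
      also have "\<dots> = (\<Sum>j\<in>?J. (v j \<bullet> h) * (\<Prod>i\<in>?J - {j}. v i \<bullet> u))"
      proof (rule sum.cong)
        fix j assume j: "j \<in> ?J"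
        then have "?P u = (v j \<bullet> u) * (\<Prod>i\<in>?J - {j}. v i \<bullet> u)"
          unfolding prod_linear_forms_def by (intro prod.remove) auto
        then show "(v j \<bullet> h) * (?P u * inverse (v j \<bullet> u)) = (v j \<bullet> h) * (\<Prod>i\<in>?J - {j}. v i \<bullet> u)"
          using u j by simp
      qed simp
      finally show "(\<Sum>j\<in>?J. (v j \<bullet> h) * (\<Prod>i\<in>?J - {j}. v i \<bullet> u))
          = h \<bullet> (?P u *\<^sub>R (\<Sum>j\<in>?J. inverse (v j \<bullet> u) *\<^sub>R v j))" by simp
    qed
    ultimately show ?thesis by (simp add: gderiv_def)
  qed
  have nz: "?P u \<noteq> 0 \<longleftrightarrow> (\<forall>j\<in>?J. v j \<bullet> u \<noteq> 0)" for u
    by (simp add: prod_linear_forms_def)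
  show ?thesis
  proof (intro set_eqI iffI)
    fix u assume "u \<in> sphere_extrema ?P"
    then obtain c where u: "norm u = 1" "?P u \<noteq> 0" and c: "GDERIV ?P u :> (c *\<^sub>R u)"
      by (auto simp: sphere_extrema_def)
    then have ne: "\<forall>j\<in>?J. v j \<bullet> u \<noteq> 0" using nz by blast
    let ?s = "\<Sum>j\<in>?J. inverse (v j \<bullet> u) *\<^sub>R v j"
    have "(\<lambda>h. h \<bullet> (c *\<^sub>R u)) = (\<lambda>h. h \<bullet> (?P u *\<^sub>R ?s))"
      using c grad[OF ne] has_derivative_unique unfolding gderiv_def by blast
    then have eq: "c *\<^sub>R u = ?P u *\<^sub>R ?s"
      by (metis (full_types) vector_eq_rdot inner_commute)
    have "u \<bullet> ?s = (\<Sum>j\<in>?J. inverse (v j \<bullet> u) * (v j \<bullet> u))"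
      by (simp add: inner_sum_right inner_commute)
    also have "\<dots> = real n" using ne by simp
    finally have "u \<bullet> (?P u *\<^sub>R ?s) = ?P u * real n" by simp
    then have "c = ?P u * real n" using u(1) eq by (metis inner_scaleR_right mult.right_neutral norm_eq_1)
    then have "?P u *\<^sub>R (real n *\<^sub>R u) = ?P u *\<^sub>R ?s" using eq by simp
    then have "?s = real n *\<^sub>R u" using u(2) by (metis scaleR_left_imp_eq)
    then show "u \<in> critical_points ?J v" using ne by (simp add: critical_points_def)
  next
    fix u assume u: "u \<in> critical_points ?J v"
    then have ne: "\<forall>j\<in>?J. v j \<bullet> u \<noteq> 0" and eq: "(\<Sum>j\<in>?J. inverse (v j \<bullet> u) *\<^sub>R v j) = real n *\<^sub>R u"
      by (auto simp: critical_points_def)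
    have "GDERIV ?P u :> ((?P u * real n) *\<^sub>R u)"
      using grad[OF ne] unfolding eq by simp
    moreover have "norm u = 1" using norm_critical_point[OF _ _ u] assms by simp
    ultimately show "u \<in> sphere_extrema ?P" using ne nz by (auto simp: sphere_extrema_def)
  qed
qed

text \<open>
  Maximise \<open>|P|\<close> over the unit vectors in the closed chamber.  The maximum is positive, so it is attained
  in the interior.  By homogeneity \<open>P(y)\<^sup>2 \<le> P(u)\<^sup>2 |y|\<^sup>2\<^sup>n\<close> for all \<open>y\<close> in the chamber, and so the
  logarithm of \<open>P(y)\<^sup>2 / |y|\<^sup>2\<^sup>n\<close> has a local maximum at \<open>u\<close> along every line through \<open>u\<close>; its derivative there
  gives the critical equation.
\<close>

lemma critical_point_in_chamber:
  fixes v :: "nat \<Rightarrow> 'a::euclidean_space"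
  assumes J: "finite J" "J \<noteq> {}" and x0: "\<forall>j\<in>J. v j \<bullet> x0 \<noteq> 0"
  shows "\<exists>u\<in>critical_points J v. sign_pattern v J u = sign_pattern v J x0"
proof -
  let ?n = "card J"
  define \<sigma> where "\<sigma> j = sgn (v j \<bullet> x0)" for j
  define K where "K = {x \<in> sphere 0 1. \<forall>j\<in>J. 0 \<le> \<sigma> j * (v j \<bullet> x)}"
  define f where "f x = (\<Prod>j\<in>J. (v j \<bullet> x)\<^sup>2)" for x
  have "x0 \<noteq> 0" using x0 J by fastforce
  then have n0: "norm x0 > 0" by simp
  have "K = sphere 0 1 \<inter> (\<Inter>j\<in>J. {x. 0 \<le> \<sigma> j * (v j \<bullet> x)})"
    by (auto simp: K_def)
  moreover have "closed (\<Inter>j\<in>J. {x. 0 \<le> \<sigma> j * (v j \<bullet> x)})"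
    by (intro closed_INT ballI closed_Collect_le continuous_intros)
  ultimately have "compact K" by (simp add: compact_Int_closed)
  moreover have normalise: "(1 / norm x) *\<^sub>R x \<in> K" if "x \<noteq> 0" "\<forall>j\<in>J. sgn (v j \<bullet> x) = \<sigma> j" for x
    using that by (auto simp: K_def mult.commute abs_mult_sgn[symmetric] simp flip: sgn_mult)
      (metis abs_ge_zero abs_sgn divide_nonneg_nonneg mult.commute norm_ge_zero)
  moreover have x0K: "(1 / norm x0) *\<^sub>R x0 \<in> K" using normalise[of x0] \<open>x0 \<noteq> 0\<close> by (simp add: \<sigma>_def)
  moreover have "continuous_on K f" unfolding f_def by (intro continuous_intros)
  ultimately obtain u where u: "u \<in> K" and max: "\<And>x. x \<in> K \<Longrightarrow> f x \<le> f u"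
    using continuous_attains_sup[of K f] by blast
  have "0 < f ((1 / norm x0) *\<^sub>R x0)"
    unfolding f_def using x0 n0 by (intro prod_pos) auto
  also have "\<dots> \<le> f u" by (rule max[OF x0K])
  finally have fu: "f u > 0" .
  then have une: "\<forall>j\<in>J. v j \<bullet> u \<noteq> 0"
    using J prod_zero[of J "\<lambda>j. (v j \<bullet> u)\<^sup>2"] by (fastforce simp: f_def)
  then have une2: "\<forall>j\<in>J. 0 < (v j \<bullet> u) * (v j \<bullet> u)"
    by (auto simp: zero_less_mult_iff linorder_neq_iff)
  have nu: "norm u = 1" using u by (simp add: K_def)
  have su: "\<forall>j\<in>J. sgn (v j \<bullet> u) = \<sigma> j"
  proof
    fix j assume "j \<in> J"
    then have "0 \<le> \<sigma> j * (v j \<bullet> u)" "v j \<bullet> u \<noteq> 0" "v j \<bullet> x0 \<noteq> 0" using u une x0 by (auto simp: K_def)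
    then show "sgn (v j \<bullet> u) = \<sigma> j" by (auto simp: \<sigma>_def sgn_if split: if_splits)
  qed
  have "(\<Sum>j\<in>J. inverse (v j \<bullet> u) *\<^sub>R v j) \<bullet> h = (real ?n *\<^sub>R u) \<bullet> h" for h
  proof -
    obtain e where e: "e > 0" "\<And>r i. \<bar>r\<bar> \<le> e \<Longrightarrow> i \<in> J \<Longrightarrow> sgn (v i \<bullet> (u + r *\<^sub>R h)) = sgn (v i \<bullet> u)"
      using small_perturbation_keeps_signs[OF J(1) une, of h] by blast
    define L where "L s = (\<Sum>j\<in>J. ln ((v j \<bullet> u + s * (v j \<bullet> h))\<^sup>2)) - real ?n * ln (1 + 2 * s * (u \<bullet> h) + s\<^sup>2 * (h \<bullet> h))" for s
    have "(L has_real_derivative (\<Sum>j\<in>J. 2 * inverse (v j \<bullet> u) * (v j \<bullet> h)) - real ?n * (2 * (u \<bullet> h))) (at 0)"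
      unfolding L_def using une une2
      by (auto intro!: derivative_eq_intros sum.cong simp: power2_eq_square field_simps)
    moreover have "L s \<le> L 0" if s: "\<bar>0 - s\<bar> < e" for s
    proof -
      let ?y = "u + s *\<^sub>R h"
      have sy: "sgn (v j \<bullet> ?y) = \<sigma> j" if "j \<in> J" for j using e(2)[of s j] s su that by simp
      have yne: "v j \<bullet> ?y \<noteq> 0" if "j \<in> J" for j using sy[OF that] su une that by (metis sgn_zero_iff)
      then have y0: "?y \<noteq> 0" using J by fastforce
      have yy: "1 + 2 * s * (u \<bullet> h) + s\<^sup>2 * (h \<bullet> h) = (norm ?y)\<^sup>2"
        unfolding power2_norm_eq_inner[of ?y] using nu
        by (simp add: norm_eq_1 inner_add_left inner_add_right inner_commute power2_eq_square algebra_simps)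
      have "f ((1 / norm ?y) *\<^sub>R ?y) = (\<Prod>j\<in>J. (v j \<bullet> ?y)\<^sup>2 / (norm ?y)\<^sup>2)"
        unfolding f_def by (rule prod.cong) (simp_all add: power_divide)
      also have "\<dots> = f ?y / ((norm ?y)\<^sup>2) ^ ?n"
        unfolding f_def by (simp add: prod_dividef)
      finally have "f ?y / ((norm ?y)\<^sup>2) ^ ?n \<le> f u"
        using max[OF normalise[of ?y]] sy y0 by simp
      then have le: "f ?y \<le> f u * ((norm ?y)\<^sup>2) ^ ?n"
        using y0 by (simp add: divide_simps)
      have fy: "f ?y > 0" unfolding f_def using yne by (intro prod_pos) simp
      have lnf: "ln (f z) = (\<Sum>j\<in>J. ln ((v j \<bullet> z)\<^sup>2))" if "\<forall>j\<in>J. v j \<bullet> z \<noteq> 0" for z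
        unfolding f_def using that J by (intro ln_prod) auto
      have "ln (f ?y) \<le> ln (f u * ((norm ?y)\<^sup>2) ^ ?n)" using le fy by simp
      also have "\<dots> = ln (f u) + real ?n * ln ((norm ?y)\<^sup>2)"
        using fu y0 by (simp add: ln_mult ln_realpow)
      finally have "ln (f ?y) - real ?n * ln ((norm ?y)\<^sup>2) \<le> ln (f u)" by simp
      then show "L s \<le> L 0"
        using lnf[of ?y] lnf[of u] yne une by (simp add: L_def yy inner_add_right)
    qed
    ultimately have "(\<Sum>j\<in>J. 2 * inverse (v j \<bullet> u) * (v j \<bullet> h)) - real ?n * (2 * (u \<bullet> h)) = 0"
      using DERIV_local_max[OF _ e(1)] by blast
    moreover have "(\<Sum>j\<in>J. 2 * inverse (v j \<bullet> u) * (v j \<bullet> h)) = 2 * (\<Sum>j\<in>J. inverse (v j \<bullet> u) * (v j \<bullet> h))"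
      by (simp add: sum_distrib_left mult_ac)
    ultimately show ?thesis by (simp add: inner_sum_left)
  qed
  then have "\<forall>h. (\<Sum>j\<in>J. inverse (v j \<bullet> u) *\<^sub>R v j) \<bullet> h = (real ?n *\<^sub>R u) \<bullet> h" by blast
  then have "(\<Sum>j\<in>J. inverse (v j \<bullet> u) *\<^sub>R v j) = real ?n *\<^sub>R u"
    by (rule iffD1[OF vector_eq_rdot])
  then have "u \<in> critical_points J v" using une by (simp add: critical_points_def)
  moreover have "sign_pattern v J u = sign_pattern v J x0"
    using su by (auto simp: sign_pattern_def \<sigma>_def)
  ultimately show ?thesis by blast
qed

section \<open>The Bezoutian of the critical equations\<close>

text \<open>
  For \<open>x = y\<close> this is the Jacobian determinant of \<open>x - (1/n) \<Sum>\<^sub>j v\<^sub>j / \<langle>v\<^sub>j, x\<rangle>\<close>; for \<open>x \<noteq> y\<close> the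
  derivatives \<open>1 / \<langle>v\<^sub>j, x\<rangle>\<^sup>2\<close> in it are replaced by difference quotients.
\<close>

definition bezoutian :: "nat set \<Rightarrow> (nat \<Rightarrow> real^'d) \<Rightarrow> real^'d \<Rightarrow> real^'d \<Rightarrow> real" where
  "bezoutian J v x y =
    det (rank_one_perturbation J (\<lambda>j. inverse (v j \<bullet> x) * inverse (v j \<bullet> y) / real (card J)) v)"

lemma bezoutian_pos:
  assumes "\<And>j. j \<in> J \<Longrightarrow> sgn (v j \<bullet> x) = sgn (v j \<bullet> y)"
  shows "bezoutian J v x y > 0"
  unfolding bezoutian_def
proof (rule det_rank_one_perturbation_pos)
  fix j assume "j \<in> J"
  then have "inverse (v j \<bullet> x) * inverse (v j \<bullet> y) \<ge> 0"
    using assms[of j] by (auto simp: sgn_if zero_le_mult_iff split: if_splits)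
  then show "0 \<le> inverse (v j \<bullet> x) * inverse (v j \<bullet> y) / real (card J)" by simp
qed

text \<open>
  Because \<open>\<langle>v\<^sub>j, x - y\<rangle> / (\<langle>v\<^sub>j, x\<rangle> \<langle>v\<^sub>j, y\<rangle>) = 1 / \<langle>v\<^sub>j, y\<rangle> - 1 / \<langle>v\<^sub>j, x\<rangle>\<close>, the critical equations for \<open>x\<close> and
  \<open>y\<close> put \<open>x - y\<close> into the kernel of the matrix.
\<close>

lemma bezoutian_off_diagonal:
  fixes v :: "nat \<Rightarrow> real^'d"
  assumes J: "finite J" "J \<noteq> {}" and x: "x \<in> critical_points J v" and y: "y \<in> critical_points J v" and ne: "x \<noteq> y"
  shows "bezoutian J v x y = 0"
proof -
  let ?n = "real (card J)"
  let ?A = "rank_one_perturbation J (\<lambda>j. inverse (v j \<bullet> x) * inverse (v j \<bullet> y) / ?n) v"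
  have n: "?n \<noteq> 0" using J by simp
  have "(\<Sum>j\<in>J. (inverse (v j \<bullet> x) * inverse (v j \<bullet> y) / ?n * (v j \<bullet> (x - y))) *\<^sub>R v j)
      = (\<Sum>j\<in>J. inverse ?n *\<^sub>R (inverse (v j \<bullet> y) *\<^sub>R v j - inverse (v j \<bullet> x) *\<^sub>R v j))"
  proof (rule sum.cong)
    fix j assume "j \<in> J"
    then have "v j \<bullet> x \<noteq> 0" "v j \<bullet> y \<noteq> 0" using x y by (auto simp: critical_points_def)
    then have "inverse (v j \<bullet> x) * inverse (v j \<bullet> y) / ?n * (v j \<bullet> (x - y))
        = inverse ?n * (inverse (v j \<bullet> y) - inverse (v j \<bullet> x))"
      using n by (simp add: inner_diff_right field_simps)
    then show "(inverse (v j \<bullet> x) * inverse (v j \<bullet> y) / ?n * (v j \<bullet> (x - y))) *\<^sub>R v j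
        = inverse ?n *\<^sub>R (inverse (v j \<bullet> y) *\<^sub>R v j - inverse (v j \<bullet> x) *\<^sub>R v j)"
      by (simp add: scaleR_diff_left[symmetric])
  qed simp
  also have "\<dots> = inverse ?n *\<^sub>R (?n *\<^sub>R y - ?n *\<^sub>R x)"
    using x y by (simp add: sum_subtractf critical_points_def flip: scaleR_sum_right)
  also have "\<dots> = y - x" using n by (simp add: scaleR_diff_right)
  finally have "?A *v (x - y) = 0"
    unfolding rank_one_perturbation_mult by simp
  then have "\<not> invertible ?A"
    using ne matrix_left_invertible_ker[of ?A] by (auto simp: invertible_left_inverse)
  then show ?thesis by (simp add: bezoutian_def invertible_det_nz)
qed

lemma sign_pattern_eq_iff:
  "sign_pattern v J x = sign_pattern v J y \<longleftrightarrow> (\<forall>j\<in>J. sgn (v j \<bullet> x) = sgn (v j \<bullet> y))"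
  by (auto simp: sign_pattern_def fun_eq_iff)

text \<open>
  Two critical points in one chamber would have a Bezoutian that is both positive and zero.  So a
  critical point is determined by its signs, and every chamber contains one.
\<close>

lemma
  fixes v :: "nat \<Rightarrow> real^'d"
  assumes J: "finite J" "J \<noteq> {}"
  shows finite_critical_points: "finite (critical_points J v)"
    and card_critical_points: "card (critical_points J v) = card (chambers {} v J)"
proof -
  have "inj_on (sign_pattern v J) (critical_points J v)"
  proof (rule inj_onI, rule ccontr)
    fix x y assume "x \<in> critical_points J v" "y \<in> critical_points J v"
      "sign_pattern v J x = sign_pattern v J y" "x \<noteq> y"
    then show False
      using bezoutian_off_diagonal[OF J, of x v y] bezoutian_pos[of J v x y]
      by (simp add: sign_pattern_eq_iff)
  qed
  moreover have "sign_pattern v J ` critical_points J v = chambers {} v J"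
  proof
    show "sign_pattern v J ` critical_points J v \<subseteq> chambers {} v J"
      by (auto simp: chambers_def critical_points_def)
    show "chambers {} v J \<subseteq> sign_pattern v J ` critical_points J v"
    proof
      fix s assume "s \<in> chambers {} v J"
      then obtain x where "s = sign_pattern v J x" "\<forall>j\<in>J. v j \<bullet> x \<noteq> 0" by (auto simp: chambers_def)
      then show "s \<in> sign_pattern v J ` critical_points J v"
        using critical_point_in_chamber[OF J, of v x] by (metis image_eqI)
    qed
  qed
  ultimately show "finite (critical_points J v)" "card (critical_points J v) = card (chambers {} v J)"
    using finite_chambers[OF J(1), of "{}" v] by (metis finite_imageD, metis card_image)
qed

section \<open>The two residue formulas\<close>

text \<open>
  No two of the vectors span the same line.  This is what makes all sets with at most one element free
  of broken circuits.
\<close>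

locale simple_arrangement =
  fixes J :: "nat set" and v :: "nat \<Rightarrow> real^'d"
  assumes finite_J: "finite J" and J_nonempty: "J \<noteq> {}"
    and nonzero: "j \<in> J \<Longrightarrow> v j \<noteq> 0"
    and nonparallel: "i \<in> J \<Longrightarrow> j \<in> J \<Longrightarrow> i \<noteq> j \<Longrightarrow> v i \<notin> span {v j}"
begin

abbreviation crit :: "(real^'d) set" where "crit \<equiv> critical_points J v"

abbreviation nbc_sets :: "nat set set" where "nbc_sets \<equiv> {B. no_broken_circuit {} v J B}"

abbreviation monomial :: "nat set \<Rightarrow> real^'d \<Rightarrow> real" where "monomial \<equiv> recip_monomial crit v"

lemma inj_on_v: "inj_on v J"
  by (rule inj_onI) (metis nonparallel singletonI span_base)

lemma finite_crit: "finite crit"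
  by (rule finite_critical_points[OF finite_J J_nonempty])

lemma finite_nbc_sets: "finite nbc_sets"
  by (rule finite_subset[of _ "Pow J"]) (auto simp: no_broken_circuit_def finite_J)

lemma card_nbc_sets_le: "card nbc_sets \<le> card crit"
  using card_nbc_le_card_chambers[OF finite_J, of "{}" v]
  by (simp add: card_critical_points[OF finite_J J_nonempty])

lemma small_sets_nbc:
  assumes "S \<subseteq> J" "card S \<le> 1"
  shows "S \<in> nbc_sets"
proof -
  have "finite S" using assms finite_J finite_subset by blast
  then consider "S = {}" | j where "S = {j}" using assms(2)
    by (metis card_0_eq card_1_singletonE le_eq_less_or_eq less_one)
  then have "v c \<notin> span ({} \<union> v ` {s\<in>S. c < s})" if c: "c \<in> J" for c
  proof cases
    case 1
    then show ?thesis using nonzero[OF c] by simp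
  next
    case (2 j)
    show ?thesis
    proof (cases "c < j")
      case True
      then have "{s\<in>S. c < s} = {j}" using 2 by auto
      then show ?thesis using nonparallel[OF c, of j] True 2 assms(1) by auto
    next
      case False
      then have "{s\<in>S. c < s} = {}" using 2 by auto
      then show ?thesis
        using nonzero[OF c] by (simp only: image_empty Un_empty_left span_empty) simp
    qed
  qed
  then show ?thesis using assms by (simp add: no_broken_circuit_def)
qed

lemma monomial_in_span:
  assumes "S \<subseteq> J" "independent (v ` S)"
  shows "monomial S \<in> fun_space.span (monomial ` {B \<in> nbc_sets. card B = card S})"
  using recip_monomial_in_nbc_span[OF finite_J inj_on_v _ assms, of crit]
  by (auto simp: critical_points_def)

definition bezout_coeff :: "nat set \<Rightarrow> real" where
  "bezout_coeff S = minor_coeff J v S / real (card J) ^ card S"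

lemma bezoutian_expansion:
  assumes "x \<in> crit" "y \<in> crit"
  shows "bezoutian J v x y = (\<Sum>S\<in>Pow J. bezout_coeff S * monomial S x * monomial S y)"
  unfolding bezoutian_def det_rank_one_perturbation[OF finite_J] using assms
  by (intro sum.cong) (auto simp: bezout_coeff_def recip_monomial_def prod_dividef prod.distrib)

definition point_mass :: "real^'d \<Rightarrow> real^'d \<Rightarrow> real" where
  "point_mass y x = (if x = y then 1 else 0)"

text \<open>
  Divide the expansion of the Bezoutian by its value on the diagonal.
\<close>

lemma point_mass_expansion:
  assumes y: "y \<in> crit"
  shows "point_mass y x = (\<Sum>S\<in>Pow J. bezout_coeff S * monomial S y / bezoutian J v y y * monomial S x)"
proof (cases "x \<in> crit")
  case True
  have pos: "bezoutian J v y y > 0" by (rule bezoutian_pos) simp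
  have "(\<Sum>S\<in>Pow J. bezout_coeff S * monomial S y / bezoutian J v y y * monomial S x)
      = bezoutian J v x y / bezoutian J v y y"
    unfolding bezoutian_expansion[OF True y] sum_divide_distrib by (simp add: mult_ac)
  also have "\<dots> = point_mass y x"
    using bezoutian_off_diagonal[OF finite_J J_nonempty True y] pos by (auto simp: point_mass_def)
  finally show ?thesis by simp
next
  case False
  then show ?thesis using y by (auto simp: point_mass_def recip_monomial_def)
qed

lemma bezout_coeff_dependent: "dependent (v ` S) \<Longrightarrow> bezout_coeff S = 0"
  by (simp add: bezout_coeff_def minor_coeff_dependent)

lemma point_mass_in_span:
  assumes y: "y \<in> crit"
  shows "point_mass y \<in> fun_space.span (monomial ` nbc_sets)"
proof -
  have eq: "point_mass y = (\<Sum>S\<in>Pow J. (\<lambda>x. bezout_coeff S * monomial S y / bezoutian J v y y * monomial S x))"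
    by (rule ext) (simp add: sum_fun_apply point_mass_expansion[OF y])
  have "(\<lambda>x. bezout_coeff S * monomial S y / bezoutian J v y y * monomial S x)
      \<in> fun_space.span (monomial ` nbc_sets)" if S: "S \<in> Pow J" for S
  proof (cases "dependent (v ` S)")
    case True
    then have "(\<lambda>x. bezout_coeff S * monomial S y / bezoutian J v y y * monomial S x) = 0"
      by (simp add: bezout_coeff_dependent fun_eq_iff)
    then show ?thesis by (metis fun_space.span_zero)
  next
    case False
    then have "monomial S \<in> fun_space.span (monomial ` nbc_sets)"
      using monomial_in_span[of S] S
        fun_space.span_mono[of "monomial ` {B \<in> nbc_sets. card B = card S}" "monomial ` nbc_sets"] by blast
    then show ?thesis by (rule fun_space.span_scale)
  qed
  then show ?thesis unfolding eq by (rule fun_space.span_sum)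
qed

lemma independent_point_masses: "fun_space.independent (point_mass ` crit)"
proof -
  have "f y = 0" if "f \<in> fun_space.span (point_mass ` crit - {point_mass y})" for f y
    using that
  proof (induction rule: fun_space.span_induct_alt)
    case (step c g f)
    then show ?case by (auto simp: point_mass_def split: if_splits)
  qed simp
  then have "point_mass y \<notin> fun_space.span (point_mass ` crit - {point_mass y})" for y
    by (metis point_mass_def zero_neq_one)
  then show ?thesis by (auto simp: fun_space.dependent_def)
qed

lemma card_point_masses: "card (point_mass ` crit) = card crit"
  by (rule card_image, rule inj_onI) (metis point_mass_def zero_neq_one)

text \<open>
  Without \<open>b\<close> the remaining products would still span the point masses, but they are fewer than the
  critical points.
\<close>

lemma nbc_monomial_not_in_span:
  assumes b: "b \<in> nbc_sets"
  shows "monomial b \<notin> fun_space.span (monomial ` (nbc_sets - {b}))"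
proof
  let ?T = "monomial ` (nbc_sets - {b})"
  assume "monomial b \<in> fun_space.span ?T"
  then have "monomial ` nbc_sets \<subseteq> fun_space.span ?T"
    using fun_space.span_superset[of ?T] by blast
  then have "fun_space.span (monomial ` nbc_sets) \<subseteq> fun_space.span ?T"
    by (rule fun_space.span_minimal[OF _ fun_space.subspace_span])
  then have "point_mass ` crit \<subseteq> fun_space.span ?T" using point_mass_in_span by blast
  moreover have "finite ?T" using finite_nbc_sets by blast
  ultimately have "card crit \<le> card ?T"
    using fun_space.independent_span_bound[OF _ independent_point_masses, of ?T]
    by (simp add: card_point_masses)
  also have "\<dots> \<le> card (nbc_sets - {b})" using finite_nbc_sets by (intro card_image_le) blast
  also have "\<dots> < card nbc_sets" using b finite_nbc_sets by (intro card_Diff1_less)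
  finally show False using card_nbc_sets_le by simp
qed

text \<open>
  Expanding \<open>\<Sum>\<^sub>y w\<^sub>b(y) \<delta>\<^sub>y = w\<^sub>b\<close> in the products \<open>w\<^sub>S\<close>, the left-hand side is the coefficient of \<open>w\<^sub>b\<close>.
  If it were not \<open>1\<close>, then \<open>w\<^sub>b\<close> would be a combination of the other \<open>w\<^sub>S\<close>, hence of the \<open>w\<^sub>B\<close> with \<open>B \<noteq> b\<close>
  free of broken circuits.  Here \<open>|b| \<le> 1\<close> matters: for \<open>|S| \<le> 1\<close> the set \<open>S\<close> itself is free of broken
  circuits, and for larger \<open>S\<close> the reduction, which keeps the size, never produces \<open>b\<close>.
\<close>

lemma weighted_sum_of_squares:
  assumes b: "b \<subseteq> J" "card b \<le> 1"
  shows "bezout_coeff b * (\<Sum>y\<in>crit. (monomial b y)\<^sup>2 / bezoutian J v y y) = 1"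
proof (rule ccontr)
  let ?V = "fun_space.span (monomial ` (nbc_sets - {b}))"
  define t where "t S = bezout_coeff S * (\<Sum>y\<in>crit. monomial b y * monomial S y / bezoutian J v y y)" for S
  assume "bezout_coeff b * (\<Sum>y\<in>crit. (monomial b y)\<^sup>2 / bezoutian J v y y) \<noteq> 1"
  then have tb: "1 - t b \<noteq> 0" by (simp add: t_def power2_eq_square)
  have "monomial b x = (\<Sum>S\<in>Pow J. t S * monomial S x)" for x
  proof -
    have "monomial b x = (\<Sum>y\<in>crit. monomial b y * point_mass y x)"
      by (cases "x \<in> crit") (simp_all add: point_mass_def recip_monomial_def finite_crit if_distrib[of "(*) _"] cong: if_cong)
    also have "\<dots> = (\<Sum>y\<in>crit. \<Sum>S\<in>Pow J. monomial b y * (bezout_coeff S * monomial S y / bezoutian J v y y * monomial S x))"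
      by (simp add: point_mass_expansion sum_distrib_left)
    also have "\<dots> = (\<Sum>S\<in>Pow J. t S * monomial S x)"
      by (subst sum.swap) (simp add: t_def sum_distrib_left sum_distrib_right mult_ac)
    finally show ?thesis .
  qed
  moreover have "(\<Sum>S\<in>Pow J. t S * monomial S x) =
      t b * monomial b x + (\<Sum>S\<in>Pow J - {b}. t S * monomial S x)" for x
    using b finite_J by (intro sum.remove) auto
  ultimately have "monomial b x - t b * monomial b x = (\<Sum>S\<in>Pow J - {b}. t S * monomial S x)" for x
    by (simp only: add_diff_cancel_left' diff_eq_eq add.commute)
  then have "(1 - t b) * monomial b x = (\<Sum>S\<in>Pow J - {b}. t S * monomial S x)" for x
    by (simp add: left_diff_distrib)
  then have eq: "monomial b x = inverse (1 - t b) * (\<Sum>S\<in>Pow J - {b}. t S * monomial S x)" for x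
    using tb by (simp add: nonzero_eq_divide_eq mult.commute flip: divide_inverse_commute)
  have "(\<lambda>x. t S * monomial S x) \<in> ?V" if S: "S \<in> Pow J - {b}" for S
  proof (cases "dependent (v ` S)")
    case True
    then have "(\<lambda>x. t S * monomial S x) = 0" by (simp add: t_def bezout_coeff_dependent fun_eq_iff)
    then show ?thesis by (metis fun_space.span_zero)
  next
    case False
    have "monomial S \<in> ?V"
    proof (cases "card S \<le> 1")
      case True
      then show ?thesis using small_sets_nbc[of S] S by (intro fun_space.span_base) blast
    next
      case False
      then have "{B \<in> nbc_sets. card B = card S} \<subseteq> nbc_sets - {b}" using b by auto
      then show ?thesis
        using monomial_in_span[of S] S \<open>independent (v ` S)\<close>
          fun_space.span_mono[OF image_mono, of _ "nbc_sets - {b}" monomial] by blast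
    qed
    then show ?thesis by (rule fun_space.span_scale)
  qed
  then have "(\<Sum>S\<in>Pow J - {b}. (\<lambda>x. t S * monomial S x)) \<in> ?V" by (rule fun_space.span_sum)
  then have "(\<lambda>x. inverse (1 - t b) * (\<Sum>S\<in>Pow J - {b}. (\<lambda>x. t S * monomial S x)) x) \<in> ?V"
    by (rule fun_space.span_scale)
  moreover have "monomial b = (\<lambda>x. inverse (1 - t b) * (\<Sum>S\<in>Pow J - {b}. (\<lambda>x. t S * monomial S x)) x)"
    unfolding sum_fun_apply by (rule ext, rule eq)
  ultimately have "monomial b \<in> ?V" by simp
  then show False using nbc_monomial_not_in_span small_sets_nbc[OF b] by blast
qed

lemma sum_inverse_bezoutian: "(\<Sum>y\<in>crit. 1 / bezoutian J v y y) = 1"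
  using weighted_sum_of_squares[of "{}"]
  by (simp add: bezout_coeff_def minor_coeff_empty recip_monomial_def)

lemma sum_inverse_square_bezoutian:
  assumes "j \<in> J"
  shows "(v j \<bullet> v j) * (\<Sum>y\<in>crit. 1 / (v j \<bullet> y)\<^sup>2 / bezoutian J v y y) = real (card J)"
proof -
  have "card J > 0" using finite_J J_nonempty by (simp add: card_gt_0_iff)
  then show ?thesis
    using weighted_sum_of_squares[of "{j}"] assms minor_coeff_singleton[OF finite_J assms, of v]
    by (simp add: bezout_coeff_def recip_monomial_def power_inverse inverse_eq_divide field_simps)
qed

end

theorem theorem1:
  fixes n :: nat and v :: "nat \<Rightarrow> real^'d"
  assumes "n \<ge> 1"
    and "\<And>j. j \<in> {1..n} \<Longrightarrow> norm (v j) = 1"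
    and "\<And>i j. i \<in> {1..n} \<Longrightarrow> j \<in> {1..n} \<Longrightarrow> i \<noteq> j \<Longrightarrow> \<not> parallel (v i) (v j)"
  defines "P \<equiv> prod_linear_forms n v"
  shows "finite (sphere_extrema P) \<and>
    (\<exists>\<mu> :: real^'d \<Rightarrow> real.
      (\<forall>u \<in> sphere_extrema P. \<mu> u > 0) \<and>
      (\<forall>u \<in> sphere_extrema P.
        \<mu> u = inverse (det (mat 1 + (1 / real n) *\<^sub>R
          (\<Sum>j=1..n. (1 / (v j \<bullet> u)\<^sup>2) *\<^sub>R outer_product (v j) (v j))))) \<and>
      (\<Sum>u \<in> sphere_extrema P.
        ((\<Sum>j=1..n. 1 / (v j \<bullet> u)\<^sup>2) - (real n)\<^sup>2) * \<mu> u) = 0)"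
proof -
  interpret simple_arrangement "{1..n}" v
  proof
    fix i j assume ij: "i \<in> {1..n}" "j \<in> {1..n}" "i \<noteq> j"
    show "v i \<notin> span {v j}"
    proof
      assume "v i \<in> span {v j}"
      then obtain c where c: "v i = c *\<^sub>R v j" by (auto simp: span_singleton)
      then have "\<bar>c\<bar> = 1" using assms(2)[OF ij(1)] assms(2)[OF ij(2)] by simp
      then have "c = 1 \<or> c = -1" by linarith
      then have "parallel (v i) (v j)" using c by (auto simp: parallel_def)
      then show False using assms(3) ij by blast
    qed
  next
    fix j assume "j \<in> {1..n}"
    then show "v j \<noteq> 0" using assms(2)[of j] by auto
  qed (use assms(1) in auto)
  have E: "sphere_extrema P = crit"
    unfolding P_def by (rule sphere_extrema_eq_critical_points[OF assms(1)])
  define \<mu> where "\<mu> u = 1 / bezoutian {1..n} v u u" for u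
  have "\<mu> u > 0" for u unfolding \<mu>_def using bezoutian_pos[of "{1..n}" v u u] by simp
  moreover have "\<mu> u = inverse (det (mat 1 + (1 / real n) *\<^sub>R
          (\<Sum>j=1..n. (1 / (v j \<bullet> u)\<^sup>2) *\<^sub>R outer_product (v j) (v j))))" for u
    by (simp add: \<mu>_def bezoutian_def scaleR_sum_right power2_eq_square inverse_eq_divide mult_ac)
  moreover have "(\<Sum>u\<in>crit. ((\<Sum>j=1..n. 1 / (v j \<bullet> u)\<^sup>2) - (real n)\<^sup>2) * \<mu> u) = 0"
  proof -
    have "(\<Sum>u\<in>crit. 1 / (v j \<bullet> u)\<^sup>2 * \<mu> u) = real n" if "j \<in> {1..n}" for j
      using sum_inverse_square_bezoutian[OF that] assms(2)[OF that] by (simp add: \<mu>_def norm_eq_1)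
    then have "(\<Sum>j=1..n. \<Sum>u\<in>crit. 1 / (v j \<bullet> u)\<^sup>2 * \<mu> u) = (real n)\<^sup>2"
      by (simp add: power2_eq_square)
    then have "(\<Sum>u\<in>crit. (\<Sum>j=1..n. 1 / (v j \<bullet> u)\<^sup>2) * \<mu> u) = (real n)\<^sup>2"
      unfolding sum_distrib_right by (subst sum.swap)
    moreover have "(\<Sum>u\<in>crit. \<mu> u) = 1"
      unfolding \<mu>_def by (rule sum_inverse_bezoutian)
    then have "(\<Sum>u\<in>crit. (real n)\<^sup>2 * \<mu> u) = (real n)\<^sup>2"
      by (simp flip: sum_distrib_left)
    ultimately show ?thesis by (simp only: left_diff_distrib sum_subtractf diff_self)
  qed
  ultimately show ?thesis unfolding E using finite_crit by blast
qed

end
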